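(* Let $a\in\mathbb{C}$ and let $\mathcal{L}_3$ be the three-dimensional BiHom-Lie algebra over $\mathbb{C}$ with basis $\{e_1,e_2,e_3\}$, structure maps $$\alpha_3=\begin{pmatrix}1&1&0\\0&1&1\\0&0&1\end{pmatrix},\qquad \beta_3=\begin{pmatrix}1&a&\frac{a^2-a}{2}\\0&1&a\\0&0&1\end{pmatrix},$$ and brackets $$[e_1,e_1]=0,\quad [e_1,e_2]=2e_1,\quad [e_1,e_3]=(2a-1)e_1+2e_2,\quad [e_2,e_1]=-2e_1,\quad [e_2,e_2]=2(1-a)e_1,$$ $$[e_2,e_3]=\tfrac{3a-a^2}{2}e_1+3e_2+2e_3,\quad [e_3,e_1]=-e_1-2e_2,\quad [e_3,e_2]=-(a+1)e_1-(1+2a)e_2-2e_3,$$ $$[e_3,e_3]=\tfrac{(1-a)(a+4)}{2}e_1+(1-a^2)e_2+2(1-a)e_3.$$ Then, for any $a\in\mathbb{C}$, the Nijenhuis operators on $\mathcal{L}_3$ are exactly the linear maps with matrix $$N=\begin{pmatrix} r_{33}&0&r_{13}\\0&r_{33}&0\\0&0&r_{33}\end{pmatrix},\qquad r_{33},r_{13}\in\mathbb{C}.$$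
   Context: Matrices act by columns: a matrix $(m_{ij})$ represents the linear map $e_j\mapsto\sum_i m_{ij}e_i$. A BiHom-Lie algebra is a 4-tuple $(L,[\cdot,\cdot],\alpha,\beta)$ with $L$ a vector space over $\mathbb{C}$, $[\cdot,\cdot]:L\times L\to L$ bilinear, $\alpha,\beta:L\to L$ linear, such that for all $x,y,z\in L$: (i) $\alpha\circ\beta=\beta\circ\alpha$; (ii) $\alpha([x,y])=[\alpha(x),\alpha(y)]$ and $\beta([x,y])=[\beta(x),\beta(y)]$; (iii) $[\beta(x),\alpha(y)]=-[\beta(y),\alpha(x)]$; (iv) $[\beta^2(x),[\beta(y),\alpha(z)]]+[\beta^2(y),[\beta(z),\alpha(x)]]+[\beta^2(z),[\beta(x),\alpha(y)]]=0$. A linear map $N:L\to L$ is a Nijenhuis operator if $N\circ\alpha=\alpha\circ N$, $N\circ\beta=\beta\circ N$, and $[N(x),N(y)]=N([N(x),y]+[x,N(y)]-N[x,y])$ for all $x,y\in L$. *)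

theory Defs
  imports "HOL-Analysis.Analysis"
begin

locale bihom_lie_algebra = vector_space scale
  for scale :: "complex \<Rightarrow> 'v::ab_group_add \<Rightarrow> 'v" +
  fixes br :: "'v \<Rightarrow> 'v \<Rightarrow> 'v" and \<alpha> \<beta> :: "'v \<Rightarrow> 'v"
  assumes linear_br_left: "Vector_Spaces.linear scale scale (\<lambda>x. br x y)"
    and linear_br_right: "Vector_Spaces.linear scale scale (\<lambda>y. br x y)"
    and linear_alpha: "Vector_Spaces.linear scale scale \<alpha>"
    and linear_beta: "Vector_Spaces.linear scale scale \<beta>"
    and alpha_beta_commute: "\<alpha> \<circ> \<beta> = \<beta> \<circ> \<alpha>"
    and alpha_br: "\<alpha> (br x y) = br (\<alpha> x) (\<alpha> y)"
    and beta_br: "\<beta> (br x y) = br (\<beta> x) (\<beta> y)"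
    and skew: "br (\<beta> x) (\<alpha> y) = - br (\<beta> y) (\<alpha> x)"
    and jacobi: "br (\<beta> (\<beta> x)) (br (\<beta> y) (\<alpha> z)) + br (\<beta> (\<beta> y)) (br (\<beta> z) (\<alpha> x))
      + br (\<beta> (\<beta> z)) (br (\<beta> x) (\<alpha> y)) = 0"

definition nijenhuis_operator ::
  "(complex \<Rightarrow> 'v::ab_group_add \<Rightarrow> 'v) \<Rightarrow> ('v \<Rightarrow> 'v \<Rightarrow> 'v) \<Rightarrow> ('v \<Rightarrow> 'v) \<Rightarrow> ('v \<Rightarrow> 'v) \<Rightarrow> ('v \<Rightarrow> 'v) \<Rightarrow> bool"
  where "nijenhuis_operator s br \<alpha> \<beta> N \<longleftrightarrow>
    Vector_Spaces.linear s s N \<and> N \<circ> \<alpha> = \<alpha> \<circ> N \<and> N \<circ> \<beta> = \<beta> \<circ> N \<and>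
    (\<forall>x y. br (N x) (N y) = N (br (N x) y + br x (N y) - N (br x y)))"

abbreviation e :: "3 \<Rightarrow> complex^3" where "e i \<equiv> axis i 1"

definition mat3 :: "complex list list \<Rightarrow> complex^3^3" where
  "mat3 rs = vector (map vector rs)"

definition alpha3 :: "complex^3 \<Rightarrow> complex^3" where
  "alpha3 x = mat3
     [[1, 1, 0],
      [0, 1, 1],
      [0, 0, 1]] *v x"

definition beta3 :: "complex \<Rightarrow> complex^3 \<Rightarrow> complex^3" where
  "beta3 a x = mat3
     [[1, a, (a^2 - a) / 2],
      [0, 1, a],
      [0, 0, 1]] *v x"

(* Entry (i, j) is the bracket of e i and e j. *)
definition basis_bracket3 :: "complex \<Rightarrow> complex^3^3^3" where
  "basis_bracket3 a = vector
    [vector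
       [0,
        2 *s e 1,
        (2 * a - 1) *s e 1 + 2 *s e 2],
     vector
       [- 2 *s e 1,
        (2 * (1 - a)) *s e 1,
        ((3 * a - a^2) / 2) *s e 1 + 3 *s e 2 + 2 *s e 3],
     vector
       [- e 1 - 2 *s e 2,
        - (a + 1) *s e 1 - (1 + 2 * a) *s e 2 - 2 *s e 3,
        ((1 - a) * (a + 4) / 2) *s e 1 + (1 - a^2) *s e 2 + (2 * (1 - a)) *s e 3]]"

definition bracket3 :: "complex \<Rightarrow> complex^3 \<Rightarrow> complex^3 \<Rightarrow> complex^3" where
  "bracket3 a x y = (\<Sum>i\<in>UNIV. \<Sum>j\<in>UNIV. (x $ i * y $ j) *s (basis_bracket3 a $ i $ j))"

lemma bracket3_basis: "bracket3 a (e i) (e j) = basis_bracket3 a $ i $ j"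
proof -
  have "bracket3 a (e i) (e j) =
      (\<Sum>k\<in>UNIV. \<Sum>l\<in>UNIV. if k = i \<and> l = j then basis_bracket3 a $ k $ l else 0)"
    unfolding bracket3_def by (intro sum.cong refl) (auto simp: axis_def)
  also have "\<dots> = (\<Sum>k\<in>UNIV. if k = i then basis_bracket3 a $ k $ j else 0)"
    by (intro sum.cong refl) auto
  finally show ?thesis by simp
qed

(* With the structure constants as given, alpha_br and skew fail at (e 3, e 3): the defects
   along e 1 are a (3 - a) / 2 and a^3 - 3 a^2 - 2 a + 2 respectively, which have no common zero.
   (Both vanish, and all axioms hold, once the e 1 coefficients of entries (2, 3) and (3, 3)
   are changed to 3 a - a^2 and (1 - a) (a + 2) / 2.)
   Hence being a bihom_lie_algebra must not be taken as a hypothesis about these data: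
   every statement about them would then hold vacuously. *)
lemma not_bihom_lie_algebra3:
  "\<not> bihom_lie_algebra vector_scalar_mult (bracket3 a) alpha3 (beta3 a)"
proof
  assume "bihom_lie_algebra vector_scalar_mult (bracket3 a) alpha3 (beta3 a)"
  then interpret bihom_lie_algebra vector_scalar_mult "bracket3 a" alpha3 "beta3 a" .
  note defs = bracket3_def basis_bracket3_def alpha3_def beta3_def mat3_def sum_3 vector_3
    matrix_vector_mult_def axis_def
  have "alpha3 (bracket3 a (e 3) (e 3)) $ 1 = bracket3 a (alpha3 (e 3)) (alpha3 (e 3)) $ 1"
    by (simp only: alpha_br)
  then have 1: "a * (3 - a) = 0"
    by (simp add: defs) (simp add: field_simps power2_eq_square)
  have "bracket3 a (beta3 a (e 3)) (alpha3 (e 3)) $ 1 = - bracket3 a (beta3 a (e 3)) (alpha3 (e 3)) $ 1"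
    using skew[of "e 3" "e 3"] by (metis vector_uminus_component)
  then have 2: "bracket3 a (beta3 a (e 3)) (alpha3 (e 3)) $ 1 = 0"
    by simp
  then have "8 * (a^3 - 3 * a^2 - 2 * a + 2) = 0"
    by (simp add: defs) (simp add: field_simps power2_eq_square power3_eq_cube)
  with 1 show False by (auto simp: power2_eq_square power3_eq_cube)
qed

end

theory Submission
  imports Defs
begin

text \<open>Write \<open>J\<close> for the nilpotent shift \<open>e 3 \<mapsto> e 2 \<mapsto> e 1 \<mapsto> 0\<close>. Since \<open>\<alpha>\<^sub>3 = 1 + J\<close> is a single
  Jordan block, the linear maps commuting with \<open>\<alpha>\<^sub>3\<close> are the polynomials \<open>r + s J + t J\<^sup>2\<close>; they
  commute with \<open>\<beta>\<^sub>3\<close>, which is itself a polynomial in \<open>J\<close>. So only the bracket identity matters: it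
  says that the Nijenhuis torsion
  \<open>[N x, N y] - N ([N x, y] + [x, N y]) + N\<^sup>2 [x, y]\<close> vanishes. The torsion does not change when a
  scalar is added to \<open>N\<close> (\<open>torsion_add_scalar\<close>), so \<open>N\<close> may be replaced by \<open>M = s J + t J\<^sup>2\<close>.

  The torsion of \<open>M\<close> at \<open>(e 2, e 3)\<close> is \<open>2 s\<^sup>2 e 1\<close>, which forces \<open>s = 0\<close>. Conversely, for
  \<open>M = t J\<^sup>2\<close> the image of \<open>M\<close> lies in the span of \<open>e 1\<close>, where \<open>[e 1, e 1] = 0\<close>; brackets with \<open>e 1\<close>
  have no \<open>e 3\<close> component and are thus killed by \<open>M\<close>; and \<open>M\<^sup>2 = 0\<close>. So every term of the
  torsion vanishes.\<close>

definition nijenhuis_torsion :: "('v::ab_group_add \<Rightarrow> 'v \<Rightarrow> 'v) \<Rightarrow> ('v \<Rightarrow> 'v) \<Rightarrow> 'v \<Rightarrow> 'v \<Rightarrow> 'v"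
  where "nijenhuis_torsion br N x y = br (N x) (N y) - N (br (N x) y + br x (N y) - N (br x y))"

text \<open>Writing \<open>N = r + M\<close>, every term of the torsion that contains \<open>r\<close> cancels: the coefficient of
  \<open>r\<^sup>2\<close> is \<open>[x, y] (1 - 2 + 1)\<close>, and the linear coefficients \<open>[M x, y]\<close>, \<open>[x, M y]\<close> and \<open>M [x, y]\<close>
  each occur with total multiplicity zero.\<close>

lemma torsion_add_scalar:
  fixes scale :: "'k::field \<Rightarrow> 'v::ab_group_add \<Rightarrow> 'v"
  assumes left: "\<And>y. Vector_Spaces.linear scale scale (\<lambda>x. br x y)"
    and right: "\<And>x. Vector_Spaces.linear scale scale (br x)"
    and M: "Vector_Spaces.linear scale scale M"
  shows "nijenhuis_torsion br (\<lambda>x. scale r x + M x) x y = nijenhuis_torsion br M x y"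
proof -
  interpret L: Vector_Spaces.linear scale scale "\<lambda>x. br x y" for y by (rule left)
  interpret R: Vector_Spaces.linear scale scale "br x" for x by (rule right)
  interpret M: Vector_Spaces.linear scale scale M by (rule M)
  show ?thesis
    unfolding nijenhuis_torsion_def L.add L.scale R.add R.scale M.add M.scale M.diff
    by (simp add: L.vs1.scale_right_distrib L.vs1.scale_right_diff_distrib algebra_simps)
qed

definition shift3 :: "complex^3 \<Rightarrow> complex^3" where
  "shift3 x = vector [x $ 2, x $ 3, 0]"

lemma linear_shift3: "Vector_Spaces.linear (*s) (*s) shift3"
  by unfold_locales (simp_all add: shift3_def vec_eq_iff forall_3 vector_3 algebra_simps)

lemma alpha3_eq_shift3: "alpha3 x = x + shift3 x"
  by (simp add: alpha3_def mat3_def shift3_def vec_eq_iff forall_3 vector_3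
      matrix_vector_mult_def sum_3)

lemma beta3_eq_shift3:
  "beta3 a x = x + a *s shift3 x + ((a^2 - a) / 2) *s shift3 (shift3 x)"
  by (simp add: beta3_def mat3_def shift3_def vec_eq_iff forall_3 vector_3
      matrix_vector_mult_def sum_3)

lemma vec3_eq_sum_axis: "(x :: complex^3) = x $ 1 *s e 1 + x $ 2 *s e 2 + x $ 3 *s e 3"
  by (simp add: vec_eq_iff forall_3 axis_def)

text \<open>The vector \<open>e 3\<close> is cyclic for \<open>shift3\<close>, so a map commuting with \<open>shift3\<close> is determined by the
  image of \<open>e 3\<close>, whose coordinates are the coefficients of the polynomial.\<close>

lemma commutes_shift3_imp_polynomial:
  assumes lin: "Vector_Spaces.linear (*s) (*s) N"
    and comm: "\<And>x. N (shift3 x) = shift3 (N x)"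
  obtains r s t where "\<And>x. N x = r *s x + (s *s shift3 x + t *s shift3 (shift3 x))"
proof
  interpret N: Vector_Spaces.linear "(*s)" "(*s)" N by (rule lin)
  have e2: "e 2 = shift3 (e 3)" and e1: "e 1 = shift3 (shift3 (e 3))"
    by (simp_all add: shift3_def vec_eq_iff forall_3 axis_def vector_3)
  fix x
  have "N x = x $ 1 *s N (e 1) + x $ 2 *s N (e 2) + x $ 3 *s N (e 3)"
    by (subst vec3_eq_sum_axis[of x]) (simp only: N.add N.scale)
  also have "\<dots> = x $ 1 *s shift3 (shift3 (N (e 3))) + x $ 2 *s shift3 (N (e 3)) + x $ 3 *s N (e 3)"
    by (simp only: e1 e2 comm)
  also have "\<dots> = N (e 3) $ 3 *s x + (N (e 3) $ 2 *s shift3 x + N (e 3) $ 1 *s shift3 (shift3 x))"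
    by (simp add: shift3_def vec_eq_iff forall_3 vector_3)
  finally show "N x = N (e 3) $ 3 *s x + (N (e 3) $ 2 *s shift3 x + N (e 3) $ 1 *s shift3 (shift3 x))" .
qed

lemma linear_shift3_polynomial:
  "Vector_Spaces.linear (*s) (*s) (\<lambda>x. s *s shift3 x + t *s shift3 (shift3 x))"
  by unfold_locales (simp_all add: shift3_def vec_eq_iff forall_3 vector_3 algebra_simps)

lemma linear_bracket3_left: "Vector_Spaces.linear (*s) (*s) (\<lambda>x. bracket3 a x y)"
  by unfold_locales (simp_all add: bracket3_def vec_eq_iff algebra_simps sum.distrib sum_distrib_left)

lemma linear_bracket3_right: "Vector_Spaces.linear (*s) (*s) (bracket3 a x)"
  by unfold_locales (simp_all add: bracket3_def vec_eq_iff algebra_simps sum.distrib sum_distrib_left)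

lemmas torsion3_add_scalar =
  torsion_add_scalar[OF linear_bracket3_left linear_bracket3_right linear_shift3_polynomial]

text \<open>Modulo what the shift kills, \<open>M = s J + t J\<^sup>2\<close> sees only three structure constants, each
  equal to \<open>2\<close>: \<open>[M (e 2), M (e 3)]\<close> is \<open>s\<^sup>2 [e 1, e 2] = 2 s\<^sup>2 e 1\<close>; the middle term
  contributes \<open>- 2 s\<^sup>2 e 1\<close> through the \<open>e 2\<close> component of \<open>[e 1, e 3]\<close>; and \<open>M\<^sup>2 [e 2, e 3]\<close> is
  \<open>2 s\<^sup>2 e 1\<close> through the \<open>e 3\<close> component of \<open>[e 2, e 3]\<close>. Neither \<open>a\<close> nor \<open>t\<close> survives.\<close>

lemma torsion3_shift3_polynomial_e2_e3:
  "nijenhuis_torsion (bracket3 a) (\<lambda>x. s *s shift3 x + t *s shift3 (shift3 x)) (e 2) (e 3) =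
    (2 * s^2) *s e 1"
  by (simp add: nijenhuis_torsion_def bracket3_def basis_bracket3_def shift3_def vec_eq_iff
      forall_3 sum_3 vector_3 axis_def power2_eq_square algebra_simps)

lemma torsion3_shift3_square:
  "nijenhuis_torsion (bracket3 a) (\<lambda>x. t *s shift3 (shift3 x)) x y = 0"
  by (simp add: nijenhuis_torsion_def bracket3_def basis_bracket3_def shift3_def vec_eq_iff
      forall_3 sum_3 vector_3 axis_def)

lemma mat3_family_eq_shift3:
  "mat3 [[r, 0, t], [0, r, 0], [0, 0, r]] *v x = r *s x + t *s shift3 (shift3 x)"
  by (simp add: mat3_def shift3_def vec_eq_iff forall_3 vector_3 matrix_vector_mult_def sum_3)

theorem theorem5p1:
  fixes a :: complex and N :: "complex^3 \<Rightarrow> complex^3"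
  shows "nijenhuis_operator vector_scalar_mult (bracket3 a) alpha3 (beta3 a) N \<longleftrightarrow>
    (\<exists>r33 r13. N = (\<lambda>x. mat3
       [[r33, 0, r13],
        [0, r33, 0],
        [0, 0, r33]] *v x))"
proof
  assume nij: "nijenhuis_operator vector_scalar_mult (bracket3 a) alpha3 (beta3 a) N"
  then have lin: "Vector_Spaces.linear (*s) (*s) N"
    and alpha: "N (alpha3 x) = alpha3 (N x)"
    and torsion: "nijenhuis_torsion (bracket3 a) N x y = 0" for x y
    by (auto simp: nijenhuis_operator_def nijenhuis_torsion_def fun_eq_iff)
  interpret N: Vector_Spaces.linear "(*s)" "(*s)" N by (rule lin)
  have "N (shift3 x) = shift3 (N x)" for x
    using alpha[of x] by (simp add: alpha3_eq_shift3 N.add)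
  then obtain r s t where N: "\<And>x. N x = r *s x + (s *s shift3 x + t *s shift3 (shift3 x))"
    using commutes_shift3_imp_polynomial[OF lin] by metis
  then have "N = (\<lambda>x. r *s x + (s *s shift3 x + t *s shift3 (shift3 x)))"
    by blast
  with torsion[of "e 2" "e 3"] have "(2 * s^2) *s e 1 = 0"
    by (simp add: torsion3_add_scalar torsion3_shift3_polynomial_e2_e3)
  then have "s = 0"
    by (simp add: vec_eq_iff forall_3 axis_def)
  then have "N = (\<lambda>x. mat3 [[r, 0, t], [0, r, 0], [0, 0, r]] *v x)"
    by (simp add: fun_eq_iff N mat3_family_eq_shift3)
  then show "\<exists>r33 r13. N = (\<lambda>x. mat3 [[r33, 0, r13], [0, r33, 0], [0, 0, r33]] *v x)"
    by blast
next
  assume "\<exists>r33 r13. N = (\<lambda>x. mat3 [[r33, 0, r13], [0, r33, 0], [0, 0, r33]] *v x)"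
  then obtain r t where N: "N = (\<lambda>x. r *s x + t *s shift3 (shift3 x))"
    by (auto simp: mat3_family_eq_shift3)
  have lin: "Vector_Spaces.linear (*s) (*s) N"
    unfolding N by unfold_locales
      (simp_all add: shift3_def vec_eq_iff forall_3 vector_3 algebra_simps)
  interpret N: Vector_Spaces.linear "(*s)" "(*s)" N by (rule lin)
  interpret S: Vector_Spaces.linear "(*s)" "(*s)" shift3 by (rule linear_shift3)
  have "nijenhuis_torsion (bracket3 a) N x y = 0" for x y
    using torsion3_add_scalar[of a r 0 t x y] by (simp add: N torsion3_shift3_square)
  moreover have "N (shift3 x) = shift3 (N x)" for x
    by (simp add: N S.add S.scale)
  ultimately show "nijenhuis_operator vector_scalar_mult (bracket3 a) alpha3 (beta3 a) N"
    using lin by (simp add: nijenhuis_operator_def nijenhuis_torsion_def fun_eq_iff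
        alpha3_eq_shift3 beta3_eq_shift3 N.add N.scale)
qed

end
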